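(* Let $G$ and $H$ be finite simple graphs, let $f_1=(A_0,A_1,A_2)$ be a Roman dominating function on $G$ of weight $\gamma_R(G)$, and let $f_2=(B_0,B_1,B_2)$ be a Roman dominating function on $H$ of weight $\gamma_R(H)$. Then $$\gamma_R(G\boxtimes H)\le \gamma_R(G)\gamma_R(H)-2|A_2||B_2|.$$
   Context: A Roman dominating function on a graph $X$ is a map $f:V(X)\to\{0,1,2\}$ such that every vertex $v$ with $f(v)=0$ has a neighbor $u$ with $f(u)=2$; its weight is $\sum_v f(v)$ and $\gamma_R(X)$ is the minimum weight. We write $f=(C_0,C_1,C_2)$ with $C_i=\{v: f(v)=i\}$. The strong product $G\boxtimes H$ has vertex set $V(G)\times V(H)$, with distinct $(g,h),(g',h')$ adjacent iff ($g=g'$ and $h\sim h'$) or ($g\sim g'$ and $h=h'$) or ($g\sim g'$ and $h\sim h'$). *)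

theory Defs
  imports "Graph_Theory.Pair_Digraph"
begin

text \<open>
  A finite simple graph is a structure satisfying \<^locale>\<open>pair_graph\<close>: the vertex set is finite and
  the arc set, a set of ordered pairs of vertices, is symmetric and irreflexive. Vertices \<open>u\<close> and
  \<open>v\<close> are adjacent iff \<open>(u, v)\<close> is an arc. The graph without vertices is allowed.
\<close>

definition strong_product ::
  "'a pair_pre_digraph \<Rightarrow> 'b pair_pre_digraph \<Rightarrow> ('a \<times> 'b) pair_pre_digraph" (infixl "\<boxtimes>" 70)
where
  "G \<boxtimes> H =
    \<lparr> pverts = pverts G \<times> pverts H,
      parcs = {((g, h), (g', h')) | g h g' h'.
        (g, h) \<in> pverts G \<times> pverts H \<and> (g', h') \<in> pverts G \<times> pverts H \<and> (g, h) \<noteq> (g', h') \<and>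
        (g = g' \<and> (h, h') \<in> parcs H \<or>
         (g, g') \<in> parcs G \<and> h = h' \<or>
         (g, g') \<in> parcs G \<and> (h, h') \<in> parcs H)} \<rparr>"

text \<open>Functions are total in HOL; the values outside the vertex set play no role below.\<close>

definition roman_dominating :: "'a pair_pre_digraph \<Rightarrow> ('a \<Rightarrow> nat) \<Rightarrow> bool" where
  "roman_dominating X f \<longleftrightarrow>
    (\<forall>v\<in>pverts X. f v \<in> {0, 1, 2}) \<and>
    (\<forall>v\<in>pverts X. f v = 0 \<longrightarrow> (\<exists>u\<in>pverts X. (v, u) \<in> parcs X \<and> f u = 2))"

definition roman_class :: "'a pair_pre_digraph \<Rightarrow> ('a \<Rightarrow> nat) \<Rightarrow> nat \<Rightarrow> 'a set" where
  "roman_class X f i = {v \<in> pverts X. f v = i}"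

definition roman_weight :: "'a pair_pre_digraph \<Rightarrow> ('a \<Rightarrow> nat) \<Rightarrow> nat" where
  "roman_weight X f = (\<Sum>v\<in>pverts X. f v)"

definition roman_domination_number :: "'a pair_pre_digraph \<Rightarrow> nat" ("\<gamma>\<^sub>R") where
  "\<gamma>\<^sub>R X = (LEAST w. \<exists>f. roman_dominating X f \<and> roman_weight X f = w)"

lemma roman_domination_number_attained:
  "\<exists>f. roman_dominating X f \<and> roman_weight X f = \<gamma>\<^sub>R X"
proof -
  have "roman_dominating X (\<lambda>_. 1)"
    by (simp add: roman_dominating_def)
  then have "\<exists>w f. roman_dominating X f \<and> roman_weight X f = w"
    by blast
  then show ?thesis
    unfolding roman_domination_number_def by (rule LeastI_ex)
qed

lemma roman_domination_number_le:
  "roman_dominating X f \<Longrightarrow> \<gamma>\<^sub>R X \<le> roman_weight X f"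
  unfolding roman_domination_number_def by (rule Least_le) blast

lemma pair_graph_strong_product:
  assumes "pair_graph G" and "pair_graph H"
  shows "pair_graph (G \<boxtimes> H)"
proof -
  interpret G: pair_graph G by fact
  interpret H: pair_graph H by fact
  let ?P = "G \<boxtimes> H"
  have arcs: "parcs ?P \<subseteq> pverts ?P \<times> pverts ?P"
    by (auto simp: strong_product_def)
  have fin: "finite (pverts ?P)"
    by (simp add: strong_product_def)
  have "finite (parcs ?P)"
    by (rule finite_subset[OF arcs]) (simp add: fin)
  moreover have "sym (parcs ?P)"
    by (rule symI) (auto simp: strong_product_def intro: G.arcs_symmetric H.arcs_symmetric)
  moreover have "fst e \<noteq> snd e" if "e \<in> parcs ?P" for e
    using that by (auto simp: strong_product_def)
  ultimately show ?thesis
    using arcs fin by unfold_locales (auto simp: symmetric_def arcs_ends_conv)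
qed

end

theory Submission
  imports Defs
begin

text \<open>
  The function \<open>min 2 (f\<^sub>1 g * f\<^sub>2 h)\<close> is Roman dominating on the strong product, and it differs
  from the product \<open>f\<^sub>1 g * f\<^sub>2 h\<close>, whose weight is the product of the weights, only on
  \<open>A\<^sub>2 \<times> B\<^sub>2\<close>, where it is 2 instead of 4.
\<close>

lemma roman_dominating_strong_product:
  assumes G: "roman_dominating G f" and H: "roman_dominating H k"
  shows "roman_dominating (G \<boxtimes> H) (\<lambda>(g, h). min 2 (f g * k h))"
  unfolding roman_dominating_def
proof (intro conjI ballI impI)
  fix v assume "v \<in> pverts (G \<boxtimes> H)"
  then obtain g h where v: "v = (g, h)" "g \<in> pverts G" "h \<in> pverts H"
    by (auto simp: strong_product_def)
  have "min 2 n \<in> {0, 1, 2}" for n :: nat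
    by auto
  then show "(case v of (g, h) \<Rightarrow> min 2 (f g * k h)) \<in> {0, 1, 2}"
    by (simp only: v prod.case)
  assume "(case v of (g, h) \<Rightarrow> min 2 (f g * k h)) = 0"
  then have zero: "f g = 0 \<or> k h = 0"
    by (simp add: v min_def split: if_splits)
  \<comment> \<open>Take \<open>g' = g\<close> if \<open>f g\<close> is positive, and a neighbour of
    value 2 if \<open>f g = 0\<close>. Staying put in one coordinate is harmless, since the strong
    product allows moving in either coordinate or in both. \<open>h'\<close> is chosen
    likewise.\<close>
  obtain g' where g': "g' \<in> pverts G" "g' = g \<or> (g, g') \<in> parcs G"
      "0 < f g'" "f g = 0 \<Longrightarrow> f g' = 2"
    using G v(2) unfolding roman_dominating_def by (metis gr0I zero_less_numeral)
  obtain h' where h': "h' \<in> pverts H" "h' = h \<or> (h, h') \<in> parcs H"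
      "0 < k h'" "k h = 0 \<Longrightarrow> k h' = 2"
    using H v(3) unfolding roman_dominating_def by (metis gr0I zero_less_numeral)
  \<comment> \<open>A coordinate of value 0 was replaced by one of value 2, and the other factor is
    at least 1.\<close>
  have two: "2 \<le> f g' * k h'"
    using zero
  proof
    assume "f g = 0"
    with g'(4) h'(3) show ?thesis by simp
  next
    assume "k h = 0"
    with h'(4) g'(3) show ?thesis by simp
  qed
  \<comment> \<open>Some coordinate has value 0 before the move, while both are positive after
    it.\<close>
  have "(g, h) \<noteq> (g', h')"
    using zero g'(3) h'(3) by (metis less_irrefl prod.inject)
  then have "(v, (g', h')) \<in> parcs (G \<boxtimes> H)"
    unfolding strong_product_def v using v(2,3) g'(1,2) h'(1,2) by simp blast
  moreover have "(g', h') \<in> pverts (G \<boxtimes> H)"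
    using g'(1) h'(1) by (simp add: strong_product_def)
  ultimately show "\<exists>u\<in>pverts (G \<boxtimes> H). (v, u) \<in> parcs (G \<boxtimes> H) \<and>
      (case u of (g, h) \<Rightarrow> min 2 (f g * k h)) = 2"
    using two by (intro bexI[of _ "(g', h')"] conjI) simp_all
qed

text \<open>The correction is added on the left because subtraction on \<open>nat\<close>
  truncates.\<close>

lemma roman_weight_strong_product:
  assumes fin: "finite (pverts G)" "finite (pverts H)"
    and G: "roman_dominating G f" and H: "roman_dominating H k"
  shows "roman_weight (G \<boxtimes> H) (\<lambda>(g, h). min 2 (f g * k h)) +
      2 * card (roman_class G f 2) * card (roman_class H k 2) =
    roman_weight G f * roman_weight H k"
proof -
  let ?V = "pverts G \<times> pverts H"
  let ?C = "roman_class G f 2 \<times> roman_class H k 2"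
  have "2 * card (roman_class G f 2) * card (roman_class H k 2) = (\<Sum>v\<in>?C. 2)"
    by (simp add: card_cartesian_product)
  \<comment> \<open>Extending by 0 to all of \<open>?V\<close> reduces the claim to a comparison at
    each vertex.\<close>
  also have "\<dots> = (\<Sum>v\<in>?V. if v \<in> ?C then 2 else 0)"
    using fin by (intro sum.mono_neutral_cong_left) (auto simp: roman_class_def)
  finally have "roman_weight (G \<boxtimes> H) (\<lambda>(g, h). min 2 (f g * k h)) +
      2 * card (roman_class G f 2) * card (roman_class H k 2) =
      (\<Sum>v\<in>?V. (case v of (g, h) \<Rightarrow> min 2 (f g * k h)) + (if v \<in> ?C then 2 else 0))"
    by (simp add: roman_weight_def strong_product_def sum.distrib)
  also have "\<dots> = (\<Sum>(g, h)\<in>?V. f g * k h)"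
  \<comment> \<open>Among the nine pairs of values only (2, 2) has a product above 2, and there 2 +
    2 = 4.\<close>
  proof (rule sum.cong[OF refl], clarify)
    fix g h assume gh: "g \<in> pverts G" "h \<in> pverts H"
    then have "f g \<in> {0, 1, 2}" "k h \<in> {0, 1, 2}"
      using G H by (simp_all add: roman_dominating_def)
    with gh show "min 2 (f g * k h) + (if (g, h) \<in> ?C then 2 else 0) = f g * k h"
      by (auto simp: roman_class_def)
  qed
  also have "\<dots> = roman_weight G f * roman_weight H k"
    by (simp add: roman_weight_def sum_product sum.cartesian_product)
  finally show ?thesis .
qed

theorem theorem23:
  fixes G :: "'a pair_pre_digraph" and H :: "'b pair_pre_digraph"
    and f\<^sub>1 :: "'a \<Rightarrow> nat" and f\<^sub>2 :: "'b \<Rightarrow> nat"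
  assumes "pair_graph G" and "pair_graph H"
    and "roman_dominating G f\<^sub>1" and "roman_weight G f\<^sub>1 = \<gamma>\<^sub>R G"
    and "roman_dominating H f\<^sub>2" and "roman_weight H f\<^sub>2 = \<gamma>\<^sub>R H"
  shows "int (\<gamma>\<^sub>R (G \<boxtimes> H)) \<le>
    int (\<gamma>\<^sub>R G) * int (\<gamma>\<^sub>R H) - 2 * int (card (roman_class G f\<^sub>1 2)) * int (card (roman_class H f\<^sub>2 2))"
proof -
  interpret G: pair_graph G by fact
  interpret H: pair_graph H by fact
  let ?f = "\<lambda>(g, h). min 2 (f\<^sub>1 g * f\<^sub>2 h)"
  have "\<gamma>\<^sub>R (G \<boxtimes> H) \<le> roman_weight (G \<boxtimes> H) ?f"
    using assms by (intro roman_domination_number_le roman_dominating_strong_product)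
  \<comment> \<open>Optimality of \<open>f\<^sub>1\<close> and \<open>f\<^sub>2\<close> turns the
    product of their weights into the product of the domination numbers.\<close>
  moreover have "roman_weight (G \<boxtimes> H) ?f +
      2 * card (roman_class G f\<^sub>1 2) * card (roman_class H f\<^sub>2 2) = \<gamma>\<^sub>R G * \<gamma>\<^sub>R H"
    using roman_weight_strong_product[of G H f\<^sub>1 f\<^sub>2] assms by simp
  ultimately have "\<gamma>\<^sub>R (G \<boxtimes> H) + 2 * card (roman_class G f\<^sub>1 2) * card (roman_class H f\<^sub>2 2)
      \<le> \<gamma>\<^sub>R G * \<gamma>\<^sub>R H"
    by linarith
  \<comment> \<open>Casting the additive form first makes the difference in the goal a genuine one
    in \<open>int\<close>.\<close>
  then have "int (\<gamma>\<^sub>R (G \<boxtimes> H) + 2 * card (roman_class G f\<^sub>1 2) * card (roman_class H f\<^sub>2 2))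
      \<le> int (\<gamma>\<^sub>R G * \<gamma>\<^sub>R H)"
    by (simp only: of_nat_le_iff)
  then show ?thesis
    by simp
qed

end
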